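(* Fix an integer $k\ge 1$. Let $\chi_k^{\ast}(p,q)$ be the formal power series in $p$ satisfying $$1-(m-1)\chi_{k}^{\ast}(p,q)-pq\prod_{j=0}^{k-1}\chi_{k}^{\ast}(pq^j,q)-pq^2\bigl(m(u-1)+1\bigr)\prod_{j=0}^{k}\chi_{k}^{\ast}(pq^j,q)=0 .$$ Then $$\chi_{k}^{\ast}(p,q)=\sum_{n\ge 0}\frac{(-pq)^{n}}{(m-1)^{(k+1)n+1}}\sum_{\mu\in\mathtt{Sch}^{B}(n;k)}m'^{\,N(H)}(m'u'+u'+1)^{N(U)}q^{d(\mu)},$$ where $N(H)$ and $N(U)$ are the numbers of horizontal and up steps in $\mu$ respectively, and $$d(\mu)=\mathrm{Area}(\widetilde{\mu})+n-N(H).$$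
   Context: The quantities $m,u,q$ are formal variables with $m-1$ invertible; $m'=m-1$ and $u'=u-1$, and power series in $p$ have coefficients in $\mathbb{Q}[m,u,q,(m-1)^{-1}]$. A $k$-Schröder path of type B of size $n$ is a lattice path from $(0,0)$ to $(kn,n)$ consisting of up steps $U=(0,1)$, down steps $D=(1,0)$ and horizontal steps $H=(1,1)$, which never goes below the line $y=x/k$; $\mathtt{Sch}^{B}(n;k)$ is the set of them. A $k$-Dyck path is such a path with no $H$ steps. For $\mu\in\mathtt{Sch}^{B}(n;k)$, $\widetilde{\mu}$ is the $k$-Dyck path obtained from $\mu$ by replacing each $H$ by $UD$. For a $k$-Dyck path $\lambda$ of size $n$, $\mathrm{Area}(\lambda)$ is the number of unit boxes below $\lambda$ and above the lowest $k$-Dyck path $(UD^k)^n$. *)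

theory Defs
  imports "HOL-Computational_Algebra.Computational_Algebra" "HOL-Library.Product_Plus"
begin

text \<open>
  The polynomial ring in \<open>m\<close>, \<open>u\<close>, \<open>q\<close> over the rationals is rendered as \<open>rat poly poly poly\<close>
  (innermost variable \<open>m\<close>, then \<open>u\<close>, outermost variable \<open>q\<close>), and its localization at \<open>m - 1\<close>
  as a subring of the fraction field.
\<close>

type_synonym coeff_field = "rat poly poly poly fract"

definition var_m :: coeff_field where "var_m = to_fract [:[:[:0, 1:]:]:]"
definition var_u :: coeff_field where "var_u = to_fract [:[:0, 1:]:]"
definition var_q :: coeff_field where "var_q = to_fract [:0, 1:]"

definition coeff_ring :: "coeff_field set" where
  "coeff_ring = {to_fract P / (var_m - 1) ^ i | P i. True}"

text \<open>The substitution \<open>p \<mapsto> p q\<^sup>j\<close>; the formal variable \<open>p\<close> is \<^const>\<open>fps_X\<close>.\<close>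

definition q_shift :: "nat \<Rightarrow> coeff_field fps \<Rightarrow> coeff_field fps" where
  "q_shift j f = fps_compose f (fps_X * fps_const (var_q ^ j))"

definition is_chi_star :: "nat \<Rightarrow> coeff_field fps \<Rightarrow> bool" where
  "is_chi_star k f \<longleftrightarrow>
     (\<forall>n. fps_nth f n \<in> coeff_ring) \<and>
     1 - fps_const (var_m - 1) * f
       - fps_X * fps_const var_q * (\<Prod>j = 0..<k. q_shift j f)
       - fps_X * fps_const (var_q ^ 2 * (var_m * (var_u - 1) + 1)) * (\<Prod>j = 0..k. q_shift j f) = 0"

datatype step = Up | Down | Horiz

fun step_vec :: "step \<Rightarrow> nat \<times> nat" where
  "step_vec Up = (0, 1)"
| "step_vec Down = (1, 0)"
| "step_vec Horiz = (1, 1)"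

definition endpoint :: "step list \<Rightarrow> nat \<times> nat" where
  "endpoint w = (\<Sum>s\<leftarrow>w. step_vec s)"

text \<open>
  Since steps are straight segments, staying weakly above the line \<open>y = x / k\<close> only has to be
  required at the lattice points visited.
\<close>

definition Sch_B :: "nat \<Rightarrow> nat \<Rightarrow> step list set" where
  "Sch_B n k = {w. endpoint w = (k * n, n) \<and>
     (\<forall>i \<le> length w. case endpoint (take i w) of (x, y) \<Rightarrow> real x / real k \<le> real y)}"

lemma finite_Sch_B: "finite (Sch_B n k)"
proof (rule finite_subset)
  have len: "length w \<le> fst (endpoint w) + snd (endpoint w)" for w
  proof (induction w)
    case (Cons s w)
    then show ?case by (cases s) (auto simp: endpoint_def)
  qed (simp add: endpoint_def)
  have "(UNIV :: step set) = {Up, Down, Horiz}"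
    by (metis UNIV_eq_I insert_iff step.exhaust)
  then show "finite {w. set w \<subseteq> (UNIV :: step set) \<and> length w \<le> k * n + n}"
    by (intro finite_lists_length_le) (metis finite.emptyI finite.insertI)
  show "Sch_B n k \<subseteq> {w. set w \<subseteq> UNIV \<and> length w \<le> k * n + n}"
  proof
    fix w assume "w \<in> Sch_B n k"
    then have "endpoint w = (k * n, n)"
      by (simp add: Sch_B_def)
    with len[of w] show "w \<in> {w. set w \<subseteq> UNIV \<and> length w \<le> k * n + n}"
      by simp
  qed
qed

fun tilde_step :: "step \<Rightarrow> step list" where
  "tilde_step Up = [Up]"
| "tilde_step Down = [Down]"
| "tilde_step Horiz = [Up, Down]"

definition tilde :: "step list \<Rightarrow> step list" where
  "tilde w = concat (map tilde_step w)"

definition lowest_Dyck :: "nat \<Rightarrow> nat \<Rightarrow> step list" where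
  "lowest_Dyck n k = concat (replicate n (Up # replicate k Down))"

text \<open>
  The pair \<open>(a, b)\<close> stands for the unit box \<open>[a, a+1] \<times> [b, b+1]\<close>. A path without horizontal
  steps crosses the column \<open>[a, a+1]\<close> by exactly one down step, at some height \<open>h\<close>: the box is
  below the path iff \<open>b + 1 \<le> h\<close>, and above it iff \<open>h \<le> b\<close>.
\<close>

definition box_below :: "step list \<Rightarrow> nat \<times> nat \<Rightarrow> bool" where
  "box_below w = (\<lambda>(a, b). \<exists>i < length w. \<exists>h.
     w ! i = Down \<and> endpoint (take i w) = (a, h) \<and> b + 1 \<le> h)"

definition box_above :: "step list \<Rightarrow> nat \<times> nat \<Rightarrow> bool" where
  "box_above w = (\<lambda>(a, b). \<exists>i < length w. \<exists>h.
     w ! i = Down \<and> endpoint (take i w) = (a, h) \<and> h \<le> b)"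

definition Area :: "nat \<Rightarrow> nat \<Rightarrow> step list \<Rightarrow> nat" where
  "Area n k w = card {c. box_below w c \<and> box_above (lowest_Dyck n k) c}"

text \<open>
  The subtraction is exact on \<^term>\<open>Sch_B n k\<close>: every horizontal step raises the height by one,
  so a path of size \<open>n\<close> has at most \<open>n\<close> of them.
\<close>

definition d_stat :: "nat \<Rightarrow> nat \<Rightarrow> step list \<Rightarrow> nat" where
  "d_stat n k w = Area n k (tilde w) + n - count_list w Horiz"

end

theory Submission
  imports Defs
begin

text \<open>
  Let \<open>E\<^sub>i\<close> be the generating function of the paths that start at level \<open>i\<close> (the level of \<open>(x, y)\<close>
  being \<open>k y - x + 1\<close>) and stop on first reaching level \<open>0\<close>. Splitting off the first step gives a
  linear recurrence
  \<open>m' E\<^sub>i\<^sub>+\<^sub>1 = E\<^sub>i - p (q\<^bsup>i+1\<^esup> E\<^sub>i\<^sub>+\<^sub>k + q\<^bsup>i+2\<^esup> (m u' + 1) E\<^sub>i\<^sub>+\<^sub>k\<^sub>+\<^sub>1)\<close>,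
  whose solutions are determined by \<open>E\<^sub>0\<close>. The functional equation says precisely that
  \<open>\<chi>(p) \<chi>(p q) \<dots> \<chi>(p q\<^bsup>i-1\<^esup>)\<close> solves it, and conversely uniqueness forces
  \<open>E\<^sub>l\<^sub>+\<^sub>i(p) = E\<^sub>l(p) E\<^sub>i(p q\<^sup>l)\<close>, so that \<open>\<chi> = E\<^sub>1\<close> is the only solution. The exponent of \<open>q\<close>
  is the area because the row of boxes to the right of an up step starting at \<open>(x, y)\<close> has
  \<open>k y - x\<close> boxes.
\<close>

section \<open>Paths killed at level zero\<close>

fun killed_path :: "nat \<Rightarrow> nat \<Rightarrow> step list \<Rightarrow> bool" where
  "killed_path k 0 w \<longleftrightarrow> w = []"
| "killed_path k (Suc i) [] \<longleftrightarrow> False"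
| "killed_path k (Suc i) (Up # w) \<longleftrightarrow> killed_path k (Suc (i + k)) w"
| "killed_path k (Suc i) (Down # w) \<longleftrightarrow> killed_path k i w"
| "killed_path k (Suc i) (Horiz # w) \<longleftrightarrow> killed_path k (i + k) w"

definition rises :: "step list \<Rightarrow> nat" where
  "rises w = count_list w Up + count_list w Horiz"

lemma rises_simps [simp]:
  "rises [] = 0" "rises (Up # w) = Suc (rises w)" "rises (Down # w) = rises w"
  "rises (Horiz # w) = Suc (rises w)" "rises (v @ w) = rises v + rises w"
  by (auto simp: rises_def)

text \<open>A rise from level \<open>Suc i\<close> opens a row of \<open>i\<close> boxes, hence
  \<open>q ^ i\<close>. The further \<open>q\<close> of an up step accounts for n - N(H) in
  \<open>d_stat\<close>, which counts up steps. The catch-all value 1 is the empty product for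
  \<open>[]\<close> at level 0, the only such case on a killed path.\<close>

fun level_weight :: "'a::comm_semiring_1 \<Rightarrow> 'a \<Rightarrow> 'a \<Rightarrow> nat \<Rightarrow> nat \<Rightarrow> step list \<Rightarrow> 'a" where
  "level_weight h c q k (Suc i) (Up # w) = c * q ^ Suc i * level_weight h c q k (Suc (i + k)) w"
| "level_weight h c q k (Suc i) (Down # w) = level_weight h c q k i w"
| "level_weight h c q k (Suc i) (Horiz # w) = h * q ^ i * level_weight h c q k (i + k) w"
| "level_weight h c q k _ _ = 1"

definition killed_paths :: "nat \<Rightarrow> nat \<Rightarrow> nat \<Rightarrow> step list set" where
  "killed_paths k n i = {w. killed_path k i w \<and> rises w = n}"

definition path_sum :: "'a::comm_semiring_1 \<Rightarrow> 'a \<Rightarrow> 'a \<Rightarrow> nat \<Rightarrow> nat \<Rightarrow> nat \<Rightarrow> 'a" where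
  "path_sum h c q k n i = (\<Sum>w\<in>killed_paths k n i. level_weight h c q k i w)"

lemma killed_paths_0: "killed_paths k n 0 = (if n = 0 then {[]} else {})"
  by (auto simp: killed_paths_def)

lemma killed_paths_Suc:
  "killed_paths k n (Suc i) = (#) Down ` killed_paths k n i \<union>
     (case n of 0 \<Rightarrow> {} | Suc n' \<Rightarrow>
        (#) Up ` killed_paths k n' (Suc (i + k)) \<union> (#) Horiz ` killed_paths k n' (i + k))"
  (is "?L = ?R")
proof (rule set_eqI)
  fix w
  show "w \<in> ?L \<longleftrightarrow> w \<in> ?R"
  proof (cases w)
    case (Cons s v)
    then show ?thesis
      by (cases s) (auto simp: killed_paths_def split: nat.split)
  qed (auto simp: killed_paths_def split: nat.split)
qed

text \<open>The induction is on rises outside and level inside: \<open>Down\<close> keeps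
  \<open>n\<close> and lowers the level; the other steps may raise the level but lower
  \<open>n\<close>.\<close>

lemma finite_killed_paths: "finite (killed_paths k n i)"
proof (induction n arbitrary: i)
  case 0
  show ?case by (induction i) (simp_all add: killed_paths_0 killed_paths_Suc)
next
  case (Suc n)
  show ?case
  proof (induction i)
    case (Suc i)
    then show ?case
      unfolding killed_paths_Suc[of k "Suc n" i] by (simp add: \<open>\<And>i. finite (killed_paths k n i)\<close>)
  qed (simp add: killed_paths_0)
qed

lemma path_sum_0: "path_sum h c q k n 0 = (if n = 0 then 1 else 0)"
  by (simp add: path_sum_def killed_paths_0)

lemma path_sum_0_Suc: "path_sum h c q k 0 (Suc i) = path_sum h c q k 0 i"
  by (simp add: path_sum_def killed_paths_Suc sum.reindex)

lemma path_sum_Suc_Suc: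
  "path_sum h c q k (Suc n) (Suc i) = path_sum h c q k (Suc n) i
     + c * q ^ Suc i * path_sum h c q k n (Suc (i + k)) + h * q ^ i * path_sum h c q k n (i + k)"
proof -
  have "path_sum h c q k (Suc n) (Suc i) =
      sum (level_weight h c q k (Suc i)) ((#) Down ` killed_paths k (Suc n) i)
    + (sum (level_weight h c q k (Suc i)) ((#) Up ` killed_paths k n (Suc (i + k)))
    + sum (level_weight h c q k (Suc i)) ((#) Horiz ` killed_paths k n (i + k)))"
    unfolding path_sum_def killed_paths_Suc[of k "Suc n"] nat.case
    by (subst sum.union_disjoint, use finite_killed_paths in auto)+
  then show ?thesis
    by (simp add: path_sum_def sum.reindex sum_distrib_left add.assoc)
qed

section \<open>Area by rows\<close>

fun row_area :: "nat \<Rightarrow> nat \<Rightarrow> nat \<Rightarrow> step list \<Rightarrow> nat" where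
  "row_area k x y [] = 0"
| "row_area k x y (Up # w) = (k * y - x) + row_area k x (Suc y) w"
| "row_area k x y (Down # w) = row_area k (Suc x) y w"
| "row_area k x y (Horiz # w) = (k * y - x) + row_area k (Suc x) (Suc y) w"

lemma endpoint_simps [simp]:
  "endpoint [] = (0, 0)" "endpoint (s # w) = step_vec s + endpoint w"
  "endpoint (v @ w) = endpoint v + endpoint w"
  by (simp_all add: endpoint_def zero_prod_def)

lemma snd_endpoint: "snd (endpoint w) = rises w"
proof (induction w)
  case (Cons s w)
  then show ?case by (cases s) auto
qed simp

text \<open>The up step of an inserted UD starts where the horizontal step did, and down steps add
  nothing.\<close>

lemma row_area_tilde: "row_area k x y (tilde w) = row_area k x y w"
proof (induction w arbitrary: x y)
  case (Cons s w)
  then show ?case by (cases s) (auto simp: tilde_def)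
qed (simp add: tilde_def)

lemma endpoint_tilde: "endpoint (tilde w) = endpoint w"
proof (induction w)
  case (Cons s w)
  then show ?case by (cases s) (auto simp: tilde_def prod_eq_iff)
qed (simp add: tilde_def)

lemma Horiz_notin_tilde: "Horiz \<notin> set (tilde w)"
proof (induction w)
  case (Cons s w)
  then show ?case by (cases s) (auto simp: tilde_def)
qed (simp add: tilde_def)

lemma row_area_append:
  "row_area k x y (v @ w) =
     row_area k x y v + row_area k (x + fst (endpoint v)) (y + snd (endpoint v)) w"
proof (induction v arbitrary: x y)
  case (Cons s v)
  then show ?case by (cases s) auto
qed simp

section \<open>Counting the boxes below a path\<close>

lemma box_below_Nil [simp]: "\<not> box_below [] c"
  by (simp add: box_below_def split: prod.splits)

lemma box_above_Nil [simp]: "\<not> box_above [] c"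
  by (simp add: box_above_def split: prod.splits)

lemma box_below_snoc:
  "box_below (w @ [s]) (a, b) \<longleftrightarrow>
     box_below w (a, b) \<or> s = Down \<and> fst (endpoint w) = a \<and> b < snd (endpoint w)"
  by (cases "endpoint w") (auto simp: box_below_def Ex_less_Suc nth_append cong: conj_cong)

lemma box_above_snoc:
  "box_above (w @ [s]) (a, b) \<longleftrightarrow>
     box_above w (a, b) \<or> s = Down \<and> fst (endpoint w) = a \<and> snd (endpoint w) \<le> b"
  by (cases "endpoint w") (auto simp: box_above_def Ex_less_Suc nth_append cong: conj_cong)

lemma box_below_bounds:
  "box_below w (a, b) \<Longrightarrow> a < fst (endpoint w) \<and> b < snd (endpoint w)"
proof (induction w rule: rev_induct)
  case (snoc s w)
  then show ?case by (cases s) (auto simp: box_below_snoc)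
qed simp

text \<open>
  The boxes of the columns that the path has not reached yet are counted too: this makes down steps
  neutral.
\<close>

definition row_boxes :: "nat \<Rightarrow> step list \<Rightarrow> (nat \<times> nat) set" where
  "row_boxes k w = {(a, b). a < k * b \<and>
     (box_below w (a, b) \<or> fst (endpoint w) \<le> a \<and> b < snd (endpoint w))}"

text \<open>An up step from \<open>(x, y)\<close> opens row \<open>y\<close> with the columns from
  \<open>x\<close> up to the line. A down step only turns the pending boxes of its column into boxes
  below the path.\<close>

lemma card_row_boxes:
  assumes "Horiz \<notin> set w"
  shows "finite (row_boxes k w) \<and> card (row_boxes k w) = row_area k 0 0 w"
  using assms
proof (induction w rule: rev_induct)
  case Nil
  have "row_boxes k [] = {}"
    by (auto simp: row_boxes_def)
  then show ?case by simp
next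
  case (snoc s w)
  obtain x y where xy: "endpoint w = (x, y)" by (cases "endpoint w")
  have IH: "finite (row_boxes k w)" "card (row_boxes k w) = row_area k 0 0 w"
    using snoc by auto
  show ?case
  proof (cases s)
    case Up
    have below: "a < x \<and> b < y" if "box_below w (a, b)" for a b
      using box_below_bounds[OF that] by (simp add: xy)
    have "(a, b) \<in> row_boxes k (w @ [s]) \<longleftrightarrow> (a, b) \<in> row_boxes k w \<union> {x..<k * y} \<times> {y}" for a b
      by (auto simp: row_boxes_def box_below_snoc xy Up less_Suc_eq dest: below)
    then have "row_boxes k (w @ [s]) = row_boxes k w \<union> {x..<k * y} \<times> {y}"
      by (metis surj_pair set_eqI)
    \<comment> \<open>Row \<open>y\<close> is new: every box counted so far lies in a lower
      row.\<close>
    moreover have "row_boxes k w \<inter> {x..<k * y} \<times> {y} = {}"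
      using below by (fastforce simp: row_boxes_def xy)
    ultimately show ?thesis
      using IH by (simp add: card_Un_disjoint row_area_append xy Up)
  next
    case Down
    have "row_boxes k (w @ [s]) = row_boxes k w"
      by (auto simp: row_boxes_def box_below_snoc xy Down)
    then show ?thesis
      using IH by (simp add: row_area_append Down)
  qed (use snoc in auto)
qed

section \<open>The lowest path and the area\<close>

lemma endpoint_replicate_Down: "endpoint (replicate j Down) = (j, 0)"
  by (induction j) auto

lemma box_above_append_Downs:
  "box_above (w @ replicate j Down) (a, b) \<longleftrightarrow> box_above w (a, b) \<or>
     fst (endpoint w) \<le> a \<and> a < fst (endpoint w) + j \<and> snd (endpoint w) \<le> b"
proof (induction j)
  case (Suc j)
  have "w @ replicate (Suc j) Down = (w @ replicate j Down) @ [Down]"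
    by (simp add: replicate_append_same)
  then show ?case
    using Suc by (auto simp only: box_above_snoc) (auto simp: endpoint_replicate_Down)
qed auto

lemma lowest_Dyck_Suc: "lowest_Dyck (Suc n) k = (lowest_Dyck n k @ [Up]) @ replicate k Down"
proof -
  have "replicate (Suc n) (Up # replicate k Down) =
      replicate n (Up # replicate k Down) @ [Up # replicate k Down]"
    by (simp add: replicate_append_same)
  then show ?thesis
    by (simp add: lowest_Dyck_def)
qed

lemma endpoint_lowest_Dyck: "endpoint (lowest_Dyck n k) = (k * n, n)"
proof (induction n)
  case (Suc n)
  then show ?case unfolding lowest_Dyck_Suc by (simp add: endpoint_replicate_Down)
qed (simp add: lowest_Dyck_def)

text \<open>The lowest path crosses column \<open>a < k * n\<close> at height
  \<open>a div k + 1\<close>, and this is at most \<open>b\<close> iff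
  \<open>a < k * b\<close>.\<close>

lemma box_above_lowest_Dyck: "box_above (lowest_Dyck n k) (a, b) \<longleftrightarrow> a < k * n \<and> a < k * b"
proof (induction n)
  case 0
  then show ?case by (simp add: lowest_Dyck_def)
next
  case (Suc n)
  have "a < k * b" if "a < k * n + k" "Suc n \<le> b"
    using that mult_le_mono2[of "Suc n" b k] by simp
  moreover have "Suc n \<le> b" if "k * n \<le> a" "a < k * b"
    using that by (metis Suc_leI le_less_trans mult_less_cancel1)
  ultimately show ?case
    unfolding lowest_Dyck_Suc box_above_append_Downs box_above_snoc
    using Suc by (auto simp: endpoint_lowest_Dyck)
qed

lemma Area_eq_row_area:
  assumes "Horiz \<notin> set w" "endpoint w = (k * n, n)"
  shows "Area n k w = row_area k 0 0 w"
proof -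
  have bounds: "a < k * n \<and> b < n" if "box_below w (a, b)" for a b
    using box_below_bounds[OF that] assms(2) by simp
  \<comment> \<open>At the endpoint of the path no pending boxes are left.\<close>
  have "\<not> (k * n \<le> a \<and> b < n \<and> a < k * b)" for a b
    using mult_le_mono2[of b n k] by linarith
  then have "{c. box_below w c \<and> box_above (lowest_Dyck n k) c} = row_boxes k w"
    using bounds assms(2) by (auto simp: row_boxes_def box_above_lowest_Dyck)
  then show ?thesis
    using card_row_boxes[OF assms(1), of k] by (simp add: Area_def)
qed

lemma d_stat_eq:
  assumes "endpoint w = (k * n, n)"
  shows "d_stat n k w = row_area k 0 0 w + count_list w Up"
proof -
  have "n = count_list w Up + count_list w Horiz"
    using snd_endpoint[of w] assms by (simp add: rises_def)
  then show ?thesis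
    using Area_eq_row_area[of "tilde w" k n] assms
    by (simp add: d_stat_def Horiz_notin_tilde endpoint_tilde row_area_tilde)
qed

section \<open>Type B Schroeder paths as killed paths\<close>

text \<open>The level of \<open>(x, y)\<close> is \<open>Suc (k * y - x)\<close>, so staying weakly
  above the line means staying at level at least 1, and the appended \<open>Down\<close> reaches
  level 0 exactly when \<open>w\<close> ends on the line.\<close>

lemma killed_path_iff_above_line:
  assumes "x \<le> k * y" "k \<ge> 1"
  shows "killed_path k (Suc (k * y - x)) (w @ [Down]) \<longleftrightarrow>
    (\<forall>i\<le>length w. x + fst (endpoint (take i w)) \<le> k * (y + snd (endpoint (take i w)))) \<and>
    x + fst (endpoint w) = k * (y + snd (endpoint w))"
  using assms(1)
proof (induction w arbitrary: x y)
  case Nil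
  have "killed_path k j [] \<longleftrightarrow> j = 0" for j
    by (cases j) auto
  with Nil show ?case by auto
next
  case (Cons s w)
  have split: "(\<forall>i\<le>length (s # w). P i) \<longleftrightarrow> P 0 \<and> (\<forall>i\<le>length w. P (Suc i))" for P
    by (metis Suc_le_mono bot_nat_0.extremum length_Cons not0_implies_Suc)
  show ?case
  proof (cases s)
    case Up
    have "k * y - x + k = k * Suc y - x" "x \<le> k * Suc y"
      using Cons.prems by simp_all
    then show ?thesis
      using Cons.IH[of x "Suc y"] Cons.prems unfolding split by (simp add: Up)
  next
    case Down
    show ?thesis
    proof (cases "x < k * y")
      case True
      then have "k * y - x = Suc (k * y - Suc x)" "Suc x \<le> k * y"
        by simp_all
      then show ?thesis
        using Cons.IH[of "Suc x" y] Cons.prems unfolding split by (simp add: Down)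
    next
      case False
      \<comment> \<open>On the line a down step ends the path too early, as
        \<open>w @ [Down]\<close> still follows. On the other side, the witness 0 is the point
        reached by this step, which is below the line.\<close>
      then have "x = k * y"
        using Cons.prems by simp
      then show ?thesis
        unfolding split by (auto simp: Down intro!: exI[of _ 0])
    qed
  next
    case Horiz
    have "k * y - x + k = Suc (k * Suc y - Suc x)" "Suc x \<le> k * Suc y"
      using Cons.prems assms(2) by simp_all
    then show ?thesis
      using Cons.IH[of "Suc x" "Suc y"] Cons.prems unfolding split by (simp add: Horiz)
  qed
qed

text \<open>For \<open>k \<ge> 1\<close> only \<open>Down\<close> lowers the level, so it must be
  the step that reaches 0.\<close>

lemma killed_path_last_Down:
  assumes "killed_path k i w" "k \<ge> 1"
  shows "i = 0 \<and> w = [] \<or> (\<exists>v. w = v @ [Down])"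
  using assms(1)
proof (induction w arbitrary: i)
  case Nil
  then show ?case by (cases i) simp_all
next
  case (Cons s w)
  then obtain j where i: "i = Suc j"
    by (cases i) auto
  show ?case
  proof (cases s)
    case Up
    then show ?thesis
      using Cons.IH[of "Suc (j + k)"] Cons.prems by (auto simp: i)
  next
    case Down
    then show ?thesis
      using Cons.IH[of j] Cons.prems by (auto simp: i)
  next
    case Horiz
    then show ?thesis
      using Cons.IH[of "j + k"] Cons.prems assms(2) by (auto simp: i)
  qed
qed

lemma killed_paths_eq_Sch_B:
  assumes "k \<ge> 1"
  shows "killed_paths k n (Suc 0) = (\<lambda>w. w @ [Down]) ` Sch_B n k"
proof -
  have line: "real x / real k \<le> real y \<longleftrightarrow> x \<le> k * y" for x y
    using assms by (simp add: pos_divide_le_eq mult.commute flip: of_nat_mult)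
  have Sch: "killed_path k (Suc 0) (w @ [Down]) \<and> rises w = n \<longleftrightarrow> w \<in> Sch_B n k" for w
    using killed_path_iff_above_line[of 0 k 0 w] assms
    by (auto simp: Sch_B_def line split_beta snd_endpoint prod_eq_iff)
  have "w \<in> (\<lambda>w. w @ [Down]) ` Sch_B n k" if w: "w \<in> killed_paths k n (Suc 0)" for w
  proof -
    obtain v where v: "w = v @ [Down]"
      using w killed_path_last_Down[of k "Suc 0" w] assms by (auto simp: killed_paths_def)
    then have "v \<in> Sch_B n k"
      using w Sch[of v] by (simp add: killed_paths_def)
    then show ?thesis
      by (simp add: v)
  qed
  moreover have "w @ [Down] \<in> killed_paths k n (Suc 0)" if "w \<in> Sch_B n k" for w
    using that Sch[of w] by (simp add: killed_paths_def)
  ultimately show ?thesis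
    by blast
qed

text \<open>The relation \<open>k * y = x + l\<close> between point and level persists along the
  path and turns the exponents of \<open>q\<close> into row lengths. The appended
  \<open>Down\<close> has weight 1.\<close>

lemma level_weight_eq:
  assumes "k * y = x + l" "killed_path k (Suc l) (w @ [Down])"
  shows "level_weight h c q k (Suc l) (w @ [Down]) =
    h ^ count_list w Horiz * c ^ count_list w Up * q ^ (row_area k x y w + count_list w Up)"
  using assms
proof (induction w arbitrary: x y l)
  case (Cons s w)
  have l: "k * y - x = l"
    using Cons.prems by simp
  show ?case
  proof (cases s)
    case Up
    have "k * Suc y = x + (l + k)"
      using Cons.prems by simp
    then show ?thesis
      using Cons.IH[of "Suc y" x "l + k"] Cons.prems(2) by (simp add: Up l power_add mult_ac)
  next
    case Down
    obtain j where "l = Suc j"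
      using Cons.prems(2) by (cases l) (auto simp: Down)
    then show ?thesis
      using Cons.IH[of y "Suc x" j] Cons.prems by (simp add: Down)
  next
    case Horiz
    \<comment> \<open>If \<open>l + k\<close> were 0, the nonempty rest \<open>w @ [Down]\<close>
      would have to be killed from level 0.\<close>
    obtain j where j: "l + k = Suc j"
      using Cons.prems(2) by (cases "l + k") (auto simp: Horiz)
    then have "k * Suc y = Suc x + j"
      using Cons.prems(1) by simp
    then show ?thesis
      using Cons.IH[of "Suc y" "Suc x" j] Cons.prems(2) j
      by (simp add: Horiz l power_add mult_ac)
  qed
qed simp

lemma path_sum_eq_Sch_B:
  assumes "k \<ge> 1"
  shows "path_sum h c q k n (Suc 0) =
    (\<Sum>\<mu>\<in>Sch_B n k. h ^ count_list \<mu> Horiz * c ^ count_list \<mu> Up * q ^ d_stat n k \<mu>)"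
proof -
  have "level_weight h c q k (Suc 0) (w @ [Down]) =
      h ^ count_list w Horiz * c ^ count_list w Up * q ^ d_stat n k w" if "w \<in> Sch_B n k" for w
  proof -
    have "killed_path k (Suc 0) (w @ [Down])"
      using that killed_paths_eq_Sch_B[OF assms, of n] by (auto simp: killed_paths_def)
    then show ?thesis
      using level_weight_eq[of k 0 0 0 w h c q] d_stat_eq[of w k n] that by (simp add: Sch_B_def)
  qed
  then show ?thesis
    by (simp add: path_sum_def killed_paths_eq_Sch_B[OF assms] sum.reindex inj_on_def)
qed

section \<open>The functional equation\<close>

text \<open>Because of the factor \<open>fps_X\<close>, coefficient \<open>n\<close> at level
  \<open>Suc i\<close> depends only on coefficient \<open>n\<close> at level \<open>i\<close> and on
  coefficients \<open>n - 1\<close> at other levels. Hence the nested induction, on \<open>n\<close>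
  and then on \<open>i\<close>.\<close>

lemma fps_recurrence_unique:
  fixes A B :: "nat \<Rightarrow> 'a::comm_ring_1 fps"
  assumes "A 0 = B 0"
    and A: "\<And>i. A (Suc i) = fps_const d *
      (A i - fps_X * (fps_const (a i) * A (i + k) + fps_const (b i) * A (Suc (i + k))))"
    and B: "\<And>i. B (Suc i) = fps_const d *
      (B i - fps_X * (fps_const (a i) * B (i + k) + fps_const (b i) * B (Suc (i + k))))"
  shows "A i = B i"
proof -
  have "fps_nth (A i) n = fps_nth (B i) n" for n i
  proof (induction n arbitrary: i)
    case 0
    show ?case
    proof (induction i)
      case (Suc i)
      then show ?case
        unfolding A[of i] B[of i] by simp
    qed (simp add: assms(1))
  next
    case (Suc n)
    note IH = Suc.IH
    show ?case
    proof (induction i)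
      case (Suc i)
      then show ?case
        unfolding A[of i] B[of i] by (simp add: IH)
    qed (simp add: assms(1))
  qed
  then show ?thesis
    by (simp add: fps_eq_iff)
qed

text \<open>Serves to multiply a recurrence by \<open>f\<close> after the substitution of p q^l for
  p: \<open>y\<close> is the q^l attached to \<open>x\<close> = p, and it moves into the
  coefficients \<open>b\<close> and \<open>c\<close>.\<close>

lemma shift_recurrence_step:
  fixes d e f x y :: "'a::comm_ring_1"
  shows "f * (d * (a - x * y * (b * g + c * h))) =
    d * (f * a - x * (y * b * (f * g) + y * c * (f * h)))"
  by (simp add: algebra_simps)

lemma var_m_minus_1_nonzero: "var_m - 1 \<noteq> 0"
proof
  assume "var_m - 1 = 0"
  then have "to_fract [:[:[:0, 1:]:]:] = (to_fract 1 :: coeff_field)"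
    by (simp add: var_m_def)
  then have "[:[:[:0, 1:]:]:] = (1 :: rat poly poly poly)"
    by (simp only: to_fract_eq_iff)
  then show False
    by (simp add: one_pCons)
qed

section \<open>The substitution of p q^j for p\<close>

lemma q_shift_mult: "q_shift j (f * g) = q_shift j f * q_shift j g"
  by (simp add: q_shift_def fps_compose_mult_distrib)

lemma q_shift_diff: "q_shift j (f - g) = q_shift j f - q_shift j g"
  by (simp add: q_shift_def fps_compose_sub_distrib)

lemma q_shift_add: "q_shift j (f + g) = q_shift j f + q_shift j g"
  by (simp add: q_shift_def fps_compose_add_distrib)

lemma q_shift_const [simp]: "q_shift j (fps_const c) = fps_const c"
  by (simp add: q_shift_def)

lemma q_shift_1 [simp]: "q_shift j 1 = 1"
  by (simp add: q_shift_def)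

lemma q_shift_X: "q_shift j fps_X = fps_X * fps_const (var_q ^ j)"
  by (simp add: q_shift_def)

lemma q_shift_q_shift: "q_shift i (q_shift j f) = q_shift (i + j) f"
proof -
  have "q_shift i (q_shift j f) = fps_compose f (q_shift i (fps_X * fps_const (var_q ^ j)))"
    unfolding q_shift_def by (subst fps_compose_assoc) simp_all
  also have "q_shift i (fps_X * fps_const (var_q ^ j)) = fps_X * fps_const (var_q ^ (i + j))"
    by (simp add: q_shift_mult q_shift_X power_add mult.assoc)
  finally show ?thesis
    by (simp add: q_shift_def)
qed

lemma q_shift_0: "q_shift 0 f = f"
  by (simp add: q_shift_def)

section \<open>The generating functions of killed paths\<close>

abbreviation up_weight :: coeff_field where
  "up_weight \<equiv> var_m * (var_u - 1) + 1"

text \<open>This is E_i, with a factor 1/m' per step and -pq per rise. A killed path from level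
  \<open>i\<close> with \<open>n\<close> rises has (k+1)n + i - N(H) steps, so the weight m' of a
  horizontal step corrects the uniform power of m'.\<close>

definition killed_fps :: "nat \<Rightarrow> nat \<Rightarrow> coeff_field fps" where
  "killed_fps k i = Abs_fps (\<lambda>n. (- var_q) ^ n / (var_m - 1) ^ ((k + 1) * n + i) *
     path_sum (var_m - 1) up_weight var_q k n i)"

lemma killed_fps_nth:
  "fps_nth (killed_fps k i) n = (- var_q) ^ n / (var_m - 1) ^ ((k + 1) * n + i) *
     path_sum (var_m - 1) up_weight var_q k n i"
  by (simp add: killed_fps_def)

lemma killed_fps_0: "killed_fps k 0 = 1"
  by (rule fps_ext) (simp add: killed_fps_def path_sum_0)

lemma killed_fps_Suc:
  "killed_fps k (Suc i) = fps_const (1 / (var_m - 1)) *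
    (killed_fps k i - fps_X * (fps_const (var_q ^ Suc i) * killed_fps k (i + k) +
       fps_const (var_q ^ (i + 2) * up_weight) * killed_fps k (Suc (i + k))))"
proof (rule fps_ext)
  fix n
  show "fps_nth (killed_fps k (Suc i)) n = fps_nth (fps_const (1 / (var_m - 1)) *
    (killed_fps k i - fps_X * (fps_const (var_q ^ Suc i) * killed_fps k (i + k) +
       fps_const (var_q ^ (i + 2) * up_weight) * killed_fps k (Suc (i + k))))) n"
  proof (cases n)
    case 0
    then show ?thesis by (simp add: killed_fps_def path_sum_0_Suc)
  next
    case (Suc n')
    define r where "r = var_m - 1"
    \<comment> \<open>The power of m' in the denominator of the horizontal term, the smallest of the
      four.\<close>
    define e where "e = (k + 1) * n' + i + k"
    have r: "r \<noteq> 0"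
      using var_m_minus_1_nonzero by (simp add: r_def)
    have e: "(k + 1) * Suc n' + Suc i = e + 2" "(k + 1) * Suc n' + i = e + 1"
      "(k + 1) * n' + (i + k) = e" "(k + 1) * n' + Suc (i + k) = e + 1"
      by (simp_all add: e_def algebra_simps)
    have "(- q) ^ Suc n' / r ^ (e + 2) * (t + c * q ^ Suc i * t\<^sub>1 + r * q ^ i * t\<^sub>2) =
      1 / r * ((- q) ^ Suc n' / r ^ (e + 1) * t - (q ^ Suc i * ((- q) ^ n' / r ^ e * t\<^sub>2) +
        q ^ (i + 2) * c * ((- q) ^ n' / r ^ (e + 1) * t\<^sub>1)))" for q c t t\<^sub>1 t\<^sub>2
      using r by (simp add: field_simps power2_eq_square)
    then show ?thesis
      by (simp only: Suc fps_mult_left_const_nth fps_sub_nth fps_add_nth fps_X_mult_nth nat.distinct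
          if_False diff_Suc_1 killed_fps_nth e path_sum_Suc_Suc flip: r_def)
  qed
qed

lemma q_shift_weights:
  "fps_const (var_q ^ Suc (l + i)) = fps_const (var_q ^ l) * fps_const (var_q ^ Suc i)"
  "fps_const (var_q ^ (l + i + 2) * c) = fps_const (var_q ^ l) * fps_const (var_q ^ (i + 2) * c)"
  by (simp_all add: power_add mult_ac)

text \<open>Combinatorially, a path from level \<open>l + i\<close> is cut at its first visit to
  level \<open>l\<close>; the part before is a path from level \<open>i\<close> lifted by
  \<open>l\<close>, which gives each rise another q^l. The proof compares recurrences in
  \<open>i\<close> instead.\<close>

lemma killed_fps_add: "killed_fps k (l + i) = killed_fps k l * q_shift l (killed_fps k i)"
proof (rule fps_recurrence_unique[where A = "\<lambda>i. killed_fps k (l + i)" and d = "1 / (var_m - 1)"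
      and a = "\<lambda>i. var_q ^ Suc (l + i)" and b = "\<lambda>i. var_q ^ (l + i + 2) * up_weight" and k = k])
  fix i
  show "killed_fps k (l + Suc i) = fps_const (1 / (var_m - 1)) *
    (killed_fps k (l + i) - fps_X * (fps_const (var_q ^ Suc (l + i)) * killed_fps k (l + (i + k)) +
       fps_const (var_q ^ (l + i + 2) * up_weight) * killed_fps k (l + Suc (i + k))))"
    using killed_fps_Suc[of k "l + i"] by (simp add: add.assoc)
  have "q_shift l (killed_fps k (Suc i)) = fps_const (1 / (var_m - 1)) *
    (q_shift l (killed_fps k i) - fps_X * fps_const (var_q ^ l) *
      (fps_const (var_q ^ Suc i) * q_shift l (killed_fps k (i + k)) +
       fps_const (var_q ^ (i + 2) * up_weight) * q_shift l (killed_fps k (Suc (i + k)))))"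
    unfolding killed_fps_Suc[of k i]
    by (simp only: q_shift_mult q_shift_diff q_shift_add q_shift_const q_shift_X)
  then show "killed_fps k l * q_shift l (killed_fps k (Suc i)) = fps_const (1 / (var_m - 1)) *
    (killed_fps k l * q_shift l (killed_fps k i) - fps_X *
      (fps_const (var_q ^ Suc (l + i)) * (killed_fps k l * q_shift l (killed_fps k (i + k))) +
       fps_const (var_q ^ (l + i + 2) * up_weight) *
         (killed_fps k l * q_shift l (killed_fps k (Suc (i + k))))))"
    unfolding q_shift_weights by (simp only: shift_recurrence_step)
qed (simp add: killed_fps_0)

lemma prod_q_shift_killed_fps: "(\<Prod>j = 0..<i. q_shift j (killed_fps k (Suc 0))) = killed_fps k i"
proof (induction i)
  case (Suc i)
  then show ?case
    using killed_fps_add[of k i "Suc 0"] by simp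
qed (simp add: killed_fps_0)

section \<open>The functional equation and its only solution\<close>

lemma diff_mult_eq_0_iff:
  fixes c d r f :: "'a::comm_ring_1"
  assumes "c * d = 1"
  shows "r - c * f = 0 \<longleftrightarrow> f = d * r"
proof
  assume "r - c * f = 0"
  then have "d * r = c * d * f"
    by (simp add: mult_ac)
  then show "f = d * r"
    by (simp add: assms)
next
  assume "f = d * r"
  then have "c * f = c * d * r"
    by (simp add: mult_ac)
  then show "r - c * f = 0"
    by (simp add: assms)
qed

text \<open>The new form is the recurrence at level 0 with E_0 = 1, the products standing for E_k
  and E_(k+1). As \<open>f\<close> still occurs on the right, the equation is only
  rearranged.\<close>

lemma chi_star_equation_iff:
  "1 - fps_const (var_m - 1) * f
     - fps_X * fps_const var_q * (\<Prod>j = 0..<k. q_shift j f)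
     - fps_X * fps_const (var_q ^ 2 * up_weight) * (\<Prod>j = 0..k. q_shift j f) = 0 \<longleftrightarrow>
   f = fps_const (1 / (var_m - 1)) *
     (1 - fps_X * (fps_const var_q * (\<Prod>j = 0..<k. q_shift j f) +
        fps_const (var_q ^ 2 * up_weight) * (\<Prod>j = 0..<Suc k. q_shift j f)))"
  (is "?lhs = 0 \<longleftrightarrow> f = fps_const ?d * ?rhs")
proof -
  have inv: "fps_const (var_m - 1) * fps_const ?d = 1"
    using var_m_minus_1_nonzero by (simp del: fps_const_sub)
  have "?lhs = ?rhs - fps_const (var_m - 1) * f"
    by (simp add: algebra_simps atLeastLessThanSuc_atLeastAtMost)
  also have "\<dots> = 0 \<longleftrightarrow> f = fps_const ?d * ?rhs"
    using inv by (rule diff_mult_eq_0_iff)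
  finally show ?thesis .
qed

lemma killed_fps_solves:
  "1 - fps_const (var_m - 1) * killed_fps k (Suc 0)
     - fps_X * fps_const var_q * (\<Prod>j = 0..<k. q_shift j (killed_fps k (Suc 0)))
     - fps_X * fps_const (var_q ^ 2 * up_weight) *
         (\<Prod>j = 0..k. q_shift j (killed_fps k (Suc 0))) = 0"
  unfolding chi_star_equation_iff
  unfolding prod_q_shift_killed_fps
  using killed_fps_Suc[of k 0] by (simp only: killed_fps_0 add_0 power_Suc0_right)

text \<open>The rearranged equation, shifted by q^i and multiplied by the partial product
  \<open>A i\<close>, is the recurrence at level \<open>i\<close>. Uniqueness then identifies every
  \<open>A i\<close>, in particular \<open>A 1 = f\<close>.\<close>

lemma is_chi_star_imp_killed_fps:
  assumes "is_chi_star k f"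
  shows "f = killed_fps k (Suc 0)"
proof -
  define A where "A i = (\<Prod>j = 0..<i. q_shift j f)" for i
  have A_add: "A (i + j) = A i * q_shift i (A j)" for i j
  proof (induction j)
    case (Suc j)
    then show ?case by (simp add: A_def q_shift_mult q_shift_q_shift mult.assoc)
  qed (simp add: A_def)
  have A_1: "A (Suc 0) = f"
    by (simp add: A_def q_shift_0)
  have f: "f = fps_const (1 / (var_m - 1)) * (1 - fps_X * (fps_const var_q * A k +
      fps_const (var_q ^ 2 * up_weight) * A (Suc k)))"
    using assms unfolding is_chi_star_def chi_star_equation_iff A_def by blast
  have "A i = killed_fps k i" for i
  proof (rule fps_recurrence_unique[where d = "1 / (var_m - 1)"
        and a = "\<lambda>i. var_q ^ Suc i" and b = "\<lambda>i. var_q ^ (i + 2) * up_weight" and k = k])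
    fix i
    have "q_shift i f = fps_const (1 / (var_m - 1)) *
      (1 - fps_X * fps_const (var_q ^ i) * (fps_const (var_q ^ Suc 0) * q_shift i (A k) +
        fps_const (var_q ^ (0 + 2) * up_weight) * q_shift i (A (Suc k))))"
      by (subst f)
        (simp only: q_shift_mult q_shift_diff q_shift_add q_shift_const q_shift_X q_shift_1
          power_one_right One_nat_def[symmetric] add_0)
    \<comment> \<open>Writing \<open>A i * 1\<close> and \<open>i + 0\<close> gives the shape of
      \<open>shift_recurrence_step\<close> and of \<open>q_shift_weights\<close> at level 0.\<close>
    then have "A (i + Suc 0) = fps_const (1 / (var_m - 1)) *
      (A i * 1 - fps_X * (fps_const (var_q ^ Suc (i + 0)) * (A i * q_shift i (A k)) +
        fps_const (var_q ^ (i + 0 + 2) * up_weight) * (A i * q_shift i (A (Suc k)))))"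
      unfolding q_shift_weights A_add[of i "Suc 0"] A_1 by (simp only: shift_recurrence_step)
    then show "A (Suc i) = fps_const (1 / (var_m - 1)) *
      (A i - fps_X * (fps_const (var_q ^ Suc i) * A (i + k) +
        fps_const (var_q ^ (i + 2) * up_weight) * A (Suc (i + k))))"
      unfolding A_add[of i k, symmetric] A_add[of i "Suc k", symmetric] by simp
  next
    show "A 0 = killed_fps k 0"
      by (simp add: A_def killed_fps_0)
  qed (rule killed_fps_Suc)
  then show ?thesis
    by (simp flip: A_1)
qed

text \<open>By the first-step recurrence the path sums are polynomials in m, u, q, so powers of m -
  1 are the only denominators.\<close>

lemma killed_fps_nth_in_coeff_ring:
  "fps_nth (killed_fps k i) n \<in> coeff_ring"
proof -
  define Z :: "coeff_field set" where "Z = range to_fract"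
  have Z_mult: "x * y \<in> Z" if "x \<in> Z" "y \<in> Z" for x y
    using that unfolding Z_def by (auto simp flip: to_fract_mult)
  have Z_add: "x + y \<in> Z" if "x \<in> Z" "y \<in> Z" for x y
    using that unfolding Z_def by (auto simp flip: to_fract_add)
  have Z_1: "1 \<in> Z" and Z_0: "0 \<in> Z"
    using rangeI[of to_fract 1] rangeI[of to_fract 0] by (simp_all add: Z_def)
  have Z_diff: "x - y \<in> Z" if "x \<in> Z" "y \<in> Z" for x y
    using that unfolding Z_def by (auto simp flip: to_fract_diff)
  have Z_power: "x ^ j \<in> Z" if "x \<in> Z" for x j
    by (induction j) (use that in \<open>simp_all add: Z_1 Z_mult\<close>)
  have vars: "var_m \<in> Z" "var_u \<in> Z" "var_q \<in> Z"
    by (simp_all add: Z_def var_m_def var_u_def var_q_def)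
  have weight: "up_weight \<in> Z"
    by (intro Z_add Z_mult Z_diff Z_1 vars)
  have path_sum: "path_sum (var_m - 1) up_weight var_q k n i \<in> Z" for n i
  proof (induction n arbitrary: i)
    case 0
    show ?case by (induction i) (simp_all add: path_sum_0 path_sum_0_Suc Z_1)
  next
    case (Suc n)
    note IH = Suc.IH
    show ?case
    proof (induction i)
      case (Suc i)
      then show ?case
        unfolding path_sum_Suc_Suc by (intro Z_add Z_mult Z_diff Z_power Z_1 vars weight IH)
    qed (simp add: path_sum_0 Z_0)
  qed
  have "(- var_q) ^ n \<in> Z"
    using Z_power[of "0 - var_q" n] Z_diff[OF Z_0 vars(3)] by simp
  then have "(- var_q) ^ n * path_sum (var_m - 1) up_weight var_q k n i \<in> Z"
    by (intro Z_mult path_sum)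
  then obtain P where
    P: "(- var_q) ^ n * path_sum (var_m - 1) up_weight var_q k n i = to_fract P"
    by (auto simp: Z_def)
  have "fps_nth (killed_fps k i) n = to_fract P / (var_m - 1) ^ ((k + 1) * n + i)"
    by (simp only: killed_fps_nth times_divide_eq_left P)
  then show ?thesis
    unfolding coeff_ring_def by blast
qed

theorem proposition4p10:
  fixes k :: nat
  assumes "k \<ge> 1"
  shows "(\<exists>!\<chi>. is_chi_star k \<chi>) \<and>
    (\<forall>\<chi>. is_chi_star k \<chi> \<longrightarrow>
      \<chi> = Abs_fps (\<lambda>n. (- var_q) ^ n / (var_m - 1) ^ ((k + 1) * n + 1) *
        (\<Sum>\<mu> \<in> Sch_B n k.
           (var_m - 1) ^ count_list \<mu> Horiz *
           ((var_m - 1) * (var_u - 1) + (var_u - 1) + 1) ^ count_list \<mu> Up *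
           var_q ^ d_stat n k \<mu>)))"
proof -
  have "(var_m - 1) * (var_u - 1) + (var_u - 1) + 1 = up_weight"
    by (simp add: algebra_simps)
  then have formula: "Abs_fps (\<lambda>n. (- var_q) ^ n / (var_m - 1) ^ ((k + 1) * n + 1) *
        (\<Sum>\<mu> \<in> Sch_B n k.
           (var_m - 1) ^ count_list \<mu> Horiz *
           ((var_m - 1) * (var_u - 1) + (var_u - 1) + 1) ^ count_list \<mu> Up *
           var_q ^ d_stat n k \<mu>)) = killed_fps k (Suc 0)"
    unfolding killed_fps_def path_sum_eq_Sch_B[OF assms] by (simp only: One_nat_def)
  have "is_chi_star k (killed_fps k (Suc 0))"
    unfolding is_chi_star_def using killed_fps_nth_in_coeff_ring killed_fps_solves by blast
  then show ?thesis
    unfolding formula using is_chi_star_imp_killed_fps by blast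
qed

end
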